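(* The Lie algebras $\widetilde{M_0}$ and $\widetilde{M_2}$ are complete, i.e. each of them has trivial center and all of its derivations are inner.
   Context: All Lie algebras are over $\mathbb{C}$, and every element is a finite linear combination of basis elements. $\widetilde{M_0}$ is the Lie algebra with basis $\{x,y,e_1,e_2,\dots\}$ and brackets $[e_i,e_1]=e_{i+1}$ ($i\ge2$), $[x,e_1]=-e_1$, $[x,e_i]=-(i-1)e_i$ ($i\ge 2$), $[y,e_i]=-e_i$ ($i\ge2$). $\widetilde{M_2}$ is the Lie algebra with basis $\{x,e_1,e_2,\dots\}$ and brackets $[e_1,e_i]=e_{i+1}$ ($i\ge2$), $[e_2,e_j]=e_{j+2}$ ($j\ge3$), $[x,e_1]=-e_1$, $[x,e_i]=-ie_i$ ($i\ge2$). In both cases brackets of basis elements not determined by these and by antisymmetry are zero. An inner derivation of $L$ is a map $ad_a\colon z\mapsto[a,z]$ with $a\in L$. *)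

theory Defs
  imports Complex_Main "HOL-Library.Poly_Mapping"
begin

section \<open>Lie algebras, derivations, completeness\<close>

locale lie_algebra = vector_space scale
  for scale :: "'k::field \<Rightarrow> 'a::ab_group_add \<Rightarrow> 'a" (infixr \<open>*s\<close> 75) +
  fixes bracket :: "'a \<Rightarrow> 'a \<Rightarrow> 'a"
  assumes bracket_add_left: "bracket (u + v) w = bracket u w + bracket v w"
    and bracket_add_right: "bracket u (v + w) = bracket u v + bracket u w"
    and bracket_scale_left: "bracket (c *s u) v = c *s bracket u v"
    and bracket_scale_right: "bracket u (c *s v) = c *s bracket u v"
    and bracket_self: "bracket u u = 0"
    and jacobi: "bracket u (bracket v w) + bracket v (bracket w u) + bracket w (bracket u v) = 0"
begin

definition center :: "'a set" where
  "center = {z. \<forall>u. bracket z u = 0}"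

definition derivation :: "('a \<Rightarrow> 'a) \<Rightarrow> bool" where
  "derivation D \<longleftrightarrow> Vector_Spaces.linear scale scale D \<and>
     (\<forall>u v. D (bracket u v) = bracket (D u) v + bracket u (D v))"

definition ad :: "'a \<Rightarrow> 'a \<Rightarrow> 'a" where
  "ad a = (\<lambda>z. bracket a z)"

definition inner_derivation :: "('a \<Rightarrow> 'a) \<Rightarrow> bool" where
  "inner_derivation D \<longleftrightarrow> (\<exists>a. D = ad a)"

end

locale complete_lie_algebra = lie_algebra +
  assumes center_trivial: "center = {0}"
    and derivations_inner: "derivation D \<Longrightarrow> inner_derivation D"


section \<open>The Lie algebra with a given basis and structure constants\<close>

text \<open>
  The complex vector space with basis \<open>'b\<close> is \<open>'b \<Rightarrow>\<^sub>0 complex\<close>, the finitely supported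
  functions; the basis vector of \<open>b\<close> is \<open>Poly_Mapping.single b 1\<close>.
\<close>

definition fsmult :: "complex \<Rightarrow> ('b \<Rightarrow>\<^sub>0 complex) \<Rightarrow> ('b \<Rightarrow>\<^sub>0 complex)" where
  "fsmult c f = Poly_Mapping.map ((*) c) f"

text \<open>
  A table \<open>T\<close> lists the prescribed brackets \<open>[a, b]\<close> of basis elements, each for only one of the
  two orders, and is \<open>0\<close> elsewhere. The bracket is the bilinear extension of \<open>T a b - T b a\<close>.
\<close>

definition bracket_of_table ::
  "('b \<Rightarrow> 'b \<Rightarrow> ('b \<Rightarrow>\<^sub>0 complex)) \<Rightarrow> ('b \<Rightarrow>\<^sub>0 complex) \<Rightarrow> ('b \<Rightarrow>\<^sub>0 complex) \<Rightarrow> ('b \<Rightarrow>\<^sub>0 complex)" where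
  "bracket_of_table T f g =
     (\<Sum>a\<in>Poly_Mapping.keys f. \<Sum>b\<in>Poly_Mapping.keys g.
        fsmult (Poly_Mapping.lookup f a * Poly_Mapping.lookup g b) (T a b - T b a))"


section \<open>The two Lie algebras\<close>

text \<open>
  Indices are shifted by one: \<open>M0_E n\<close> and \<open>M2_E n\<close> stand for the basis element \<open>e\<^sub>n\<^sub>+\<^sub>1\<close>.
  The brackets in the usual indexing are recovered in the lemmas \<open>M0_brackets\<close> and
  \<open>M2_brackets\<close> below.
\<close>

datatype M0_basis = M0_X | M0_Y | M0_E nat

fun M0_table :: "M0_basis \<Rightarrow> M0_basis \<Rightarrow> (M0_basis \<Rightarrow>\<^sub>0 complex)" where
  "M0_table (M0_E (Suc n)) (M0_E 0) = Poly_Mapping.single (M0_E (Suc (Suc n))) 1"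
| "M0_table M0_X (M0_E 0) = Poly_Mapping.single (M0_E 0) (- 1)"
| "M0_table M0_X (M0_E (Suc n)) = Poly_Mapping.single (M0_E (Suc n)) (- of_nat (n + 1))"
| "M0_table M0_Y (M0_E (Suc n)) = Poly_Mapping.single (M0_E (Suc n)) (- 1)"
| "M0_table _ _ = 0"

definition M0_bracket ::
  "(M0_basis \<Rightarrow>\<^sub>0 complex) \<Rightarrow> (M0_basis \<Rightarrow>\<^sub>0 complex) \<Rightarrow> (M0_basis \<Rightarrow>\<^sub>0 complex)" where
  "M0_bracket = bracket_of_table M0_table"

datatype M2_basis = M2_X | M2_E nat

fun M2_table :: "M2_basis \<Rightarrow> M2_basis \<Rightarrow> (M2_basis \<Rightarrow>\<^sub>0 complex)" where
  "M2_table (M2_E 0) (M2_E (Suc n)) = Poly_Mapping.single (M2_E (Suc (Suc n))) 1"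
| "M2_table (M2_E (Suc 0)) (M2_E (Suc (Suc n))) = Poly_Mapping.single (M2_E (n + 4)) 1"
| "M2_table M2_X (M2_E n) = Poly_Mapping.single (M2_E n) (- of_nat (n + 1))"
| "M2_table _ _ = 0"

definition M2_bracket ::
  "(M2_basis \<Rightarrow>\<^sub>0 complex) \<Rightarrow> (M2_basis \<Rightarrow>\<^sub>0 complex) \<Rightarrow> (M2_basis \<Rightarrow>\<^sub>0 complex)" where
  "M2_bracket = bracket_of_table M2_table"


section \<open>Both brackets are Lie brackets\<close>

lemma lookup_fsmult [simp]: "Poly_Mapping.lookup (fsmult c f) k = c * Poly_Mapping.lookup f k"
  unfolding fsmult_def by (simp add: Poly_Mapping.map.rep_eq when_def)

lemma vector_space_fsmult: "vector_space (fsmult :: complex \<Rightarrow> ('b \<Rightarrow>\<^sub>0 complex) \<Rightarrow> _)"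
  by unfold_locales
    (auto intro!: poly_mapping_eqI simp: lookup_add algebra_simps)

interpretation fs: vector_space "fsmult :: complex \<Rightarrow> ('b \<Rightarrow>\<^sub>0 complex) \<Rightarrow> _"
  by (rule vector_space_fsmult)

lemma fsmult_single [simp]: "fsmult c (Poly_Mapping.single k d) = Poly_Mapping.single k (c * d)"
  by (rule poly_mapping_eqI) (simp add: lookup_single when_def)

lemma bracket_of_table_superset:
  assumes "finite A" "finite B" "Poly_Mapping.keys f \<subseteq> A" "Poly_Mapping.keys g \<subseteq> B"
  shows "bracket_of_table T f g =
     (\<Sum>a\<in>A. \<Sum>b\<in>B. fsmult (Poly_Mapping.lookup f a * Poly_Mapping.lookup g b) (T a b - T b a))"
proof -
  have "bracket_of_table T f g =
     (\<Sum>a\<in>Poly_Mapping.keys f. \<Sum>b\<in>B.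
        fsmult (Poly_Mapping.lookup f a * Poly_Mapping.lookup g b) (T a b - T b a))"
    unfolding bracket_of_table_def
    by (intro sum.cong refl sum.mono_neutral_left assms) (auto simp: in_keys_iff)
  also have "\<dots> = (\<Sum>a\<in>A. \<Sum>b\<in>B.
        fsmult (Poly_Mapping.lookup f a * Poly_Mapping.lookup g b) (T a b - T b a))"
    by (intro sum.mono_neutral_left assms) (auto simp: in_keys_iff)
  finally show ?thesis .
qed

lemma bracket_of_table_add_left:
  "bracket_of_table T (u + v) w = bracket_of_table T u w + bracket_of_table T v w"
proof -
  let ?A = "Poly_Mapping.keys u \<union> Poly_Mapping.keys v \<union> Poly_Mapping.keys (u + v)"
  show ?thesis
    by (simp add: bracket_of_table_superset[of ?A "Poly_Mapping.keys w"] lookup_add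
        distrib_right fs.scale_left_distrib sum.distrib le_supI1)
qed

lemma bracket_of_table_add_right:
  "bracket_of_table T w (u + v) = bracket_of_table T w u + bracket_of_table T w v"
proof -
  let ?A = "Poly_Mapping.keys u \<union> Poly_Mapping.keys v \<union> Poly_Mapping.keys (u + v)"
  show ?thesis
    by (simp add: bracket_of_table_superset[of "Poly_Mapping.keys w" ?A] lookup_add
        distrib_left fs.scale_left_distrib sum.distrib le_supI1)
qed

lemma bracket_of_table_scale_left:
  "bracket_of_table T (fsmult c u) v = fsmult c (bracket_of_table T u v)"
proof -
  have "Poly_Mapping.keys (fsmult c u) \<subseteq> Poly_Mapping.keys u"
    by (auto simp: in_keys_iff)
  then show ?thesis
    by (simp add: bracket_of_table_superset[of "Poly_Mapping.keys u" "Poly_Mapping.keys v"]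
        fs.scale_sum_right mult.assoc)
qed

lemma bracket_of_table_scale_right:
  "bracket_of_table T u (fsmult c v) = fsmult c (bracket_of_table T u v)"
proof -
  have "Poly_Mapping.keys (fsmult c v) \<subseteq> Poly_Mapping.keys v"
    by (auto simp: in_keys_iff)
  then show ?thesis
    by (simp add: bracket_of_table_superset[of "Poly_Mapping.keys u" "Poly_Mapping.keys v"]
        fs.scale_sum_right mult.left_commute)
qed

lemma bracket_of_table_swap: "bracket_of_table T u v = - bracket_of_table T v u"
proof -
  have "bracket_of_table T v u = (\<Sum>a\<in>Poly_Mapping.keys u. \<Sum>b\<in>Poly_Mapping.keys v.
        fsmult (Poly_Mapping.lookup v b * Poly_Mapping.lookup u a) (T b a - T a b))"
    unfolding bracket_of_table_def by (rule sum.swap)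
  also have "\<dots> = - bracket_of_table T u v"
    unfolding bracket_of_table_def sum_negf[symmetric] fs.scale_minus_right[symmetric]
    by (simp add: mult.commute)
  finally show ?thesis by simp
qed

lemma bracket_of_table_self: "bracket_of_table T u u = 0"
proof (rule poly_mapping_eqI)
  fix k
  have "Poly_Mapping.lookup (bracket_of_table T u u) k =
      - Poly_Mapping.lookup (bracket_of_table T u u) k"
    by (metis bracket_of_table_swap lookup_uminus)
  then show "Poly_Mapping.lookup (bracket_of_table T u u) k = Poly_Mapping.lookup 0 k"
    by simp
qed

lemma bracket_of_table_single [simp]:
  "bracket_of_table T (Poly_Mapping.single a c) (Poly_Mapping.single b d) =
     fsmult (c * d) (T a b - T b a)"
  by (simp add: bracket_of_table_superset[of "{a}" "{b}"])

lemma bracket_of_table_zero [simp]: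
  "bracket_of_table T 0 u = 0" "bracket_of_table T u 0 = 0"
  by (simp_all add: bracket_of_table_def)

lemma bracket_of_table_minus [simp]:
  "bracket_of_table T (- u) v = - bracket_of_table T u v"
  "bracket_of_table T u (- v) = - bracket_of_table T u v"
  using bracket_of_table_scale_left[of T "- 1" u v] bracket_of_table_scale_right[of T u "- 1" v]
  by simp_all

lemma poly_mapping_expand:
  "f = (\<Sum>a\<in>Poly_Mapping.keys f. fsmult (Poly_Mapping.lookup f a) (Poly_Mapping.single a 1))"
  by (rule poly_mapping_eqI)
    (auto simp: lookup_sum lookup_single when_def sum.delta in_keys_iff if_distrib cong: if_cong)

lemma linear_eq_0:
  assumes add: "\<And>f g. F (f + g) = F f + F g"
    and scale: "\<And>c f. F (fsmult c f) = fsmult c (F f)"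
    and basis: "\<And>a. F (Poly_Mapping.single a 1) = 0"
  shows "F f = 0"
proof -
  have zero: "F 0 = 0"
    using scale[of 0 0] by simp
  have "F (\<Sum>a\<in>A. fsmult (h a) (Poly_Mapping.single a 1)) = 0" if "finite A" for A h
    using that by (induction A) (use add scale basis zero in \<open>simp_all del: fsmult_single\<close>)
  then show ?thesis
    by (subst poly_mapping_expand) simp
qed

lemma lie_algebra_bracket_of_table:
  assumes jacobi: "\<And>a b c. let e = (\<lambda>k. Poly_Mapping.single k 1); br = bracket_of_table T
     in br (e a) (br (e b) (e c)) + br (e b) (br (e c) (e a)) + br (e c) (br (e a) (e b)) = 0"
  shows "lie_algebra fsmult (bracket_of_table T)"
proof -
  let ?br = "bracket_of_table T"
  let ?J = "\<lambda>u v w. ?br u (?br v w) + ?br v (?br w u) + ?br w (?br u v)"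
  note lin = bracket_of_table_add_left bracket_of_table_add_right bracket_of_table_scale_left
    bracket_of_table_scale_right fs.scale_right_distrib add_ac
  have 1: "?J (Poly_Mapping.single a 1) (Poly_Mapping.single b 1) (Poly_Mapping.single c 1) = 0"
    for a b c
    using jacobi[of a b c] by (simp only: Let_def)
  have 2: "?J (Poly_Mapping.single a 1) (Poly_Mapping.single b 1) w = 0" for a b w
    by (rule linear_eq_0[where F = "\<lambda>w. ?J (Poly_Mapping.single a 1) (Poly_Mapping.single b 1) w"])
      (rule 1 | simp only: lin)+
  have 3: "?J (Poly_Mapping.single a 1) v w = 0" for a v w
    by (rule linear_eq_0[where F = "\<lambda>v. ?J (Poly_Mapping.single a 1) v w"])
      (rule 2 | simp only: lin)+
  have "?J u v w = 0" for u v w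
    by (rule linear_eq_0[where F = "\<lambda>u. ?J u v w"]) (rule 3 | simp only: lin)+
  then show ?thesis
    by unfold_locales (simp_all add: bracket_of_table_add_left bracket_of_table_add_right
        bracket_of_table_scale_left bracket_of_table_scale_right bracket_of_table_self)
qed

lemma M0_basis_cases:
  obtains "a = M0_X" | "a = M0_Y" | "a = M0_E 0" | n where "a = M0_E (Suc n)"
  by (metis M0_basis.exhaust not0_implies_Suc)

lemma M2_basis_cases:
  obtains "a = M2_X" | "a = M2_E 0" | "a = M2_E 1" | n where "a = M2_E (Suc (Suc n))"
  by (metis M2_basis.exhaust not0_implies_Suc One_nat_def)

lemmas bracket_simps =
  bracket_of_table_add_left bracket_of_table_add_right
  single_uminus [symmetric] single_add [symmetric] single_diff [symmetric]

theorem lie_algebra_M0: "lie_algebra fsmult M0_bracket"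
  unfolding M0_bracket_def
proof (rule lie_algebra_bracket_of_table)
  fix a b c
  show "let e = (\<lambda>k. Poly_Mapping.single k 1); br = bracket_of_table M0_table
     in br (e a) (br (e b) (e c)) + br (e b) (br (e c) (e a)) + br (e c) (br (e a) (e b)) = 0"
    by (cases a rule: M0_basis_cases; cases b rule: M0_basis_cases; cases c rule: M0_basis_cases)
      (simp_all add: Let_def bracket_simps algebra_simps)
qed

theorem lie_algebra_M2: "lie_algebra fsmult M2_bracket"
  unfolding M2_bracket_def
proof (rule lie_algebra_bracket_of_table)
  fix a b c
  show "let e = (\<lambda>k. Poly_Mapping.single k 1); br = bracket_of_table M2_table
     in br (e a) (br (e b) (e c)) + br (e b) (br (e c) (e a)) + br (e c) (br (e a) (e b)) = 0"
    by (cases a rule: M2_basis_cases; cases b rule: M2_basis_cases; cases c rule: M2_basis_cases)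
      (simp_all add: Let_def bracket_simps algebra_simps numeral_eq_Suc)
qed


section \<open>The brackets in the usual indexing\<close>

lemma M0_brackets:
  defines "e \<equiv> \<lambda>i. Poly_Mapping.single (M0_E (i - 1)) 1"
    and "x \<equiv> Poly_Mapping.single M0_X 1" and "y \<equiv> Poly_Mapping.single M0_Y 1"
  shows "i \<ge> 2 \<Longrightarrow> M0_bracket (e i) (e 1) = e (i + 1)"
    and "M0_bracket x (e 1) = - e 1"
    and "i \<ge> 2 \<Longrightarrow> M0_bracket x (e i) = - fsmult (of_nat (i - 1)) (e i)"
    and "i \<ge> 2 \<Longrightarrow> M0_bracket y (e i) = - e i"
    and "M0_bracket x y = 0" and "M0_bracket y (e 1) = 0"
    and "i \<ge> 2 \<Longrightarrow> j \<ge> 2 \<Longrightarrow> M0_bracket (e i) (e j) = 0"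
proof -
  have *: "\<exists>n. i = Suc (Suc n)" if "i \<ge> 2" for i
    using that by (intro exI[of _ "i - 2"]) simp
  note defs = M0_bracket_def e_def x_def y_def
  show "M0_bracket x (e 1) = - e 1" "M0_bracket x y = 0" "M0_bracket y (e 1) = 0"
    by (simp_all add: defs single_uminus)
  show "M0_bracket (e i) (e 1) = e (i + 1)" if "i \<ge> 2"
    using *[OF that] by (auto simp: defs)
  show "M0_bracket x (e i) = - fsmult (of_nat (i - 1)) (e i)" if "i \<ge> 2"
    using *[OF that] by (auto simp: defs single_uminus [symmetric])
  show "M0_bracket y (e i) = - e i" if "i \<ge> 2"
    using *[OF that] by (auto simp: defs single_uminus)
  show "M0_bracket (e i) (e j) = 0" if "i \<ge> 2" "j \<ge> 2"
    using *[OF that(1)] *[OF that(2)] by (auto simp: defs)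
qed

lemma M2_brackets:
  defines "e \<equiv> \<lambda>i. Poly_Mapping.single (M2_E (i - 1)) 1"
    and "x \<equiv> Poly_Mapping.single M2_X 1"
  shows "i \<ge> 2 \<Longrightarrow> M2_bracket (e 1) (e i) = e (i + 1)"
    and "j \<ge> 3 \<Longrightarrow> M2_bracket (e 2) (e j) = e (j + 2)"
    and "M2_bracket x (e 1) = - e 1"
    and "i \<ge> 2 \<Longrightarrow> M2_bracket x (e i) = - fsmult (of_nat i) (e i)"
    and "i \<ge> 3 \<Longrightarrow> j \<ge> 3 \<Longrightarrow> M2_bracket (e i) (e j) = 0"
proof -
  have *: "\<exists>n. i = Suc (Suc n)" if "i \<ge> 2" for i
    using that by (intro exI[of _ "i - 2"]) simp
  have **: "\<exists>n. i = Suc (Suc (Suc n))" if "i \<ge> 3" for i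
    using that by (intro exI[of _ "i - 3"]) simp
  note defs = M2_bracket_def e_def x_def
  show "M2_bracket x (e 1) = - e 1"
    by (simp add: defs single_uminus)
  show "M2_bracket (e 1) (e i) = e (i + 1)" if "i \<ge> 2"
    using *[OF that] by (auto simp: defs)
  show "M2_bracket (e 2) (e j) = e (j + 2)" if "j \<ge> 3"
    using **[OF that] by (auto simp: defs numeral_eq_Suc)
  show "M2_bracket x (e i) = - fsmult (of_nat i) (e i)" if "i \<ge> 2"
    using *[OF that] by (auto simp: defs single_uminus [symmetric] algebra_simps)
  show "M2_bracket (e i) (e j) = 0" if "i \<ge> 3" "j \<ge> 3"
    using **[OF that(1)] **[OF that(2)] by (auto simp: defs)
qed

end

theory Submission
  imports Defs
begin

text \<open>
  Both algebras are graded by the eigenvalues of a single element \<open>h\<close> that acts diagonally on the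
  given basis: \<open>h = x + y\<close> for the first algebra, \<open>h = x\<close> for the second. In both cases \<open>e\<^sub>i\<close> has
  weight \<open>- i\<close>, so the nonzero weights are pairwise distinct, and the space \<open>L\<^sub>0\<close> of weight \<open>0\<close>
  is spanned by \<open>x, y\<close>, respectively by \<open>x\<close>. It acts diagonally on the basis too, and faithfully on
  the \<open>e\<^sub>i\<close>.

  A central element commutes with \<open>h\<close>, hence lies in \<open>L\<^sub>0\<close>, and by faithfulness it vanishes.

  Let \<open>D\<close> be a derivation. The components of \<open>D h\<close> of nonzero weight can be divided by their weights
  because \<open>ad h\<close> is invertible there, and only finitely many of them occur; so subtracting an inner
  derivation puts \<open>D h\<close> into \<open>L\<^sub>0\<close> (\<open>inner_correction\<close>). Comparing coefficients in
  \<open>D [h, b] = [D h, b] + [h, D b]\<close> now shows that \<open>D\<close> preserves weight spaces, hence multiplies each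
  basis element \<open>b\<close> of nonzero weight by a scalar \<open>\<lambda> b\<close>. Such a map commutes with
  the action of \<open>L\<^sub>0\<close> on those \<open>b\<close>, so faithfulness forces \<open>D\<close> to vanish on \<open>L\<^sub>0\<close>
  (\<open>derivation_diagonal\<close>).

  The eigenvalues \<open>\<lambda>\<close> are additive along nonzero brackets. It remains to see that every additive
  \<open>\<lambda>\<close> is the action of an element of \<open>L\<^sub>0\<close> (\<open>complete_if_additive_inner\<close>). In the first algebra
  \<open>[e\<^sub>i, e\<^sub>1] = e\<^sub>i\<^sub>+\<^sub>1\<close> leaves two free parameters, \<open>\<lambda> e\<^sub>1\<close> and \<open>\<lambda> e\<^sub>2\<close>, which \<open>x\<close> and \<open>y\<close> realize. In the
  second one \<open>[e\<^sub>2, e\<^sub>3] = e\<^sub>5\<close> imposes in addition \<open>\<lambda> e\<^sub>2 = 2 \<lambda> e\<^sub>1\<close>, and the remaining parameter is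
  realized by \<open>x\<close>.
\<close>

section \<open>Linear maps in coordinates\<close>

lemma linear_fsmult_sum:
  assumes "Vector_Spaces.linear fsmult fsmult F"
  shows "F (\<Sum>i\<in>A. g i) = (\<Sum>i\<in>A. F (g i))"
proof -
  interpret Vector_Spaces.linear fsmult fsmult F by fact
  show ?thesis by (rule sum)
qed

lemma lookup_linear:
  assumes F: "Vector_Spaces.linear fsmult fsmult F"
  shows "Poly_Mapping.lookup (F u) c =
    (\<Sum>a\<in>Poly_Mapping.keys u.
       Poly_Mapping.lookup u a * Poly_Mapping.lookup (F (Poly_Mapping.single a 1)) c)"
proof -
  interpret Vector_Spaces.linear fsmult fsmult F by fact
  have "F u = (\<Sum>a\<in>Poly_Mapping.keys u.
      fsmult (Poly_Mapping.lookup u a) (F (Poly_Mapping.single a 1)))"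
    by (subst (1) poly_mapping_expand) (simp only: linear_fsmult_sum[OF F] scale)
  then show ?thesis
    by (simp add: lookup_sum)
qed

lemma linear_eqI:
  assumes F: "Vector_Spaces.linear fsmult fsmult F" and G: "Vector_Spaces.linear fsmult fsmult G"
    and "\<And>a. F (Poly_Mapping.single a 1) = G (Poly_Mapping.single a 1)"
  shows "F = G"
proof (intro ext poly_mapping_eqI)
  show "Poly_Mapping.lookup (F u) c = Poly_Mapping.lookup (G u) c" for u c
    using lookup_linear[OF F, of u c] lookup_linear[OF G, of u c] by (simp only: assms(3))
qed

section \<open>Derivations of a Lie algebra\<close>

context lie_algebra
begin

lemma bracket_swap: "bracket u v = - bracket v u"
proof -
  have "bracket u v + bracket v u = 0"
    using bracket_self[of "u + v"] unfolding bracket_add_left bracket_add_right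
    by (simp add: bracket_self add.commute)
  then show ?thesis
    by (simp add: eq_neg_iff_add_eq_0)
qed

lemma linear_bracket_right: "Vector_Spaces.linear scale scale (\<lambda>u. bracket a u)"
  by unfold_locales (simp_all add: bracket_add_right bracket_scale_right)

lemma linear_bracket_left: "Vector_Spaces.linear scale scale (\<lambda>u. bracket u a)"
  by unfold_locales (simp_all add: bracket_add_left bracket_scale_left)

lemma bracket_minus_left: "bracket (- u) v = - bracket u v"
  using bracket_scale_left[of "- 1" u v] by simp

lemma bracket_minus_right: "bracket u (- v) = - bracket u v"
  using bracket_scale_right[of u "- 1" v] by simp

lemma derivation_ad: "derivation (ad a)"
proof -
  have "bracket a (bracket u v) = bracket (bracket a u) v + bracket u (bracket a v)" for u v
    using jacobi[of a u v] bracket_swap[of v a] bracket_swap[of v "bracket a u"]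
    by (simp add: bracket_minus_right algebra_simps add_eq_0_iff)
  then show ?thesis
    unfolding derivation_def ad_def by (simp add: linear_bracket_right)
qed

lemma derivation_diff:
  assumes "derivation D" "derivation E"
  shows "derivation (\<lambda>u. D u - E u)"
proof -
  have "Vector_Spaces.linear scale scale (\<lambda>u. D u - E u)"
    using assms
    unfolding derivation_def Vector_Spaces.linear_def module_hom_def module_hom_axioms_def
    by (simp add: scale_right_diff_distrib)
  moreover have "bracket (u - v) w = bracket u w - bracket v w" for u v w
    using bracket_add_left[of "u - v" v w] by simp
  moreover have "bracket w (u - v) = bracket w u - bracket w v" for u v w
    using bracket_add_right[of w "u - v" v] by simp
  ultimately show ?thesis
    using assms unfolding derivation_def by (simp add: algebra_simps)
qed

end

section \<open>Lie algebras with a diagonal action of the weight-zero space\<close>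

text \<open>
  The nonzero weight spaces of \<open>ad h\<close> are lines spanned by basis vectors; the weight-zero space may have
  any dimension, but it is a torus that is separated by its weights on those lines.
\<close>

locale weighted_lie_algebra = lie_algebra fsmult br
  for br :: "('b \<Rightarrow>\<^sub>0 complex) \<Rightarrow> ('b \<Rightarrow>\<^sub>0 complex) \<Rightarrow> ('b \<Rightarrow>\<^sub>0 complex)" +
  fixes h :: "'b \<Rightarrow>\<^sub>0 complex" and w :: "'b \<Rightarrow> complex"
  assumes br_h: "br h (Poly_Mapping.single b 1) = Poly_Mapping.single b (w b)"
    and weights_distinct: "w a = w b \<Longrightarrow> w a \<noteq> 0 \<Longrightarrow> a = b"
    and zero_diagonal: "w a = 0 \<Longrightarrow> c \<noteq> b \<Longrightarrow>
      Poly_Mapping.lookup (br (Poly_Mapping.single a 1) (Poly_Mapping.single b 1)) c = 0"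
    and zero_faithful: "(\<And>b. w b \<noteq> 0 \<Longrightarrow> Poly_Mapping.lookup z b = 0) \<Longrightarrow>
      (\<And>b. w b \<noteq> 0 \<Longrightarrow> br z (Poly_Mapping.single b 1) = 0) \<Longrightarrow> z = 0"
begin

abbreviation vec :: "'b \<Rightarrow> ('b \<Rightarrow>\<^sub>0 complex)" where
  "vec b \<equiv> Poly_Mapping.single b 1"

lemma lookup_br_h: "Poly_Mapping.lookup (br h u) c = w c * Poly_Mapping.lookup u c"
  by (subst lookup_linear[OF linear_bracket_right])
    (simp add: br_h lookup_single when_def in_keys_iff if_distrib cong: if_cong)

lemma zero_weight_diagonal:
  assumes "\<And>a. w a \<noteq> 0 \<Longrightarrow> Poly_Mapping.lookup z a = 0" "c \<noteq> b"
  shows "Poly_Mapping.lookup (br z (vec b)) c = 0"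
  by (subst lookup_linear[OF linear_bracket_left], rule sum.neutral)
    (use assms zero_diagonal in \<open>auto simp: in_keys_iff\<close>)

lemma vec_multipleI:
  assumes "\<And>c. c \<noteq> b \<Longrightarrow> Poly_Mapping.lookup u c = 0"
  shows "u = fsmult (Poly_Mapping.lookup u b) (vec b)"
  by (rule poly_mapping_eqI) (use assms in \<open>auto simp: lookup_single when_def\<close>)

lemma center_trivial_weighted: "center = {0}"
proof -
  have "z = 0" if z: "\<And>u. br z u = 0" for z
  proof (rule zero_faithful)
    fix b
    have "br h z = 0"
      using z[of h] bracket_swap[of h z] by simp
    then show "w b \<noteq> 0 \<Longrightarrow> Poly_Mapping.lookup z b = 0"
      using lookup_br_h[of z b] by simp
  qed (rule z)
  moreover have "br 0 u = 0" for u
    using bracket_add_left[of 0 0 u] by simp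
  ultimately show ?thesis
    unfolding center_def by auto
qed

text \<open>
  The operator \<open>ad h\<close> is invertible on the nonzero weight spaces. The value \<open>x / 0 = 0\<close> discards the
  components of \<open>D h\<close> of weight \<open>0\<close>.
\<close>

lemma inner_correction:
  obtains a where "\<And>c. w c \<noteq> 0 \<Longrightarrow> Poly_Mapping.lookup (d - br a h) c = 0"
proof
  define a where "a = (\<Sum>k\<in>Poly_Mapping.keys d.
    Poly_Mapping.single k (- Poly_Mapping.lookup d k / w k))"
  have a: "Poly_Mapping.lookup a c = - Poly_Mapping.lookup d c / w c" for c
    by (simp add: a_def lookup_sum lookup_single when_def in_keys_iff if_distrib cong: if_cong)
  show "w c \<noteq> 0 \<Longrightarrow> Poly_Mapping.lookup (d - br a h) c = 0" for c
    by (simp add: bracket_swap[of a h] lookup_minus lookup_br_h a lookup_add)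
qed

text \<open>
  Once \<open>E h\<close> has weight \<open>0\<close>, its bracket with \<open>b\<close> contributes to \<open>E [h, b] = [E h, b] + [h, E b]\<close> only
  along \<open>b\<close>, so away from \<open>b\<close> the coefficients of \<open>E b\<close> are supported on the weight of \<open>b\<close>. On the
  weight-zero space this does not yet make \<open>E\<close> diagonal; there the faithful action decides.
\<close>

lemma derivation_diagonal:
  assumes E: "derivation E" and Eh: "\<And>c. w c \<noteq> 0 \<Longrightarrow> Poly_Mapping.lookup (E h) c = 0"
  obtains l where "\<And>b. E (vec b) = Poly_Mapping.single b (l b)" "\<And>b. w b = 0 \<Longrightarrow> l b = 0"
proof -
  have lin: "Vector_Spaces.linear fsmult fsmult E"
    and der: "E (br u v) = br (E u) v + br u (E v)" for u v
    using E unfolding derivation_def by auto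
  interpret E: Vector_Spaces.linear fsmult fsmult E by fact
  have off: "Poly_Mapping.lookup (E (vec b)) c = 0" if "c \<noteq> b" "w b \<noteq> w c" for b c
  proof -
    have "E (br h (vec b)) = fsmult (w b) (E (vec b))"
      using E.scale[of "w b" "vec b"] by (simp add: br_h)
    then have "w b * Poly_Mapping.lookup (E (vec b)) c =
        Poly_Mapping.lookup (br (E h) (vec b) + br h (E (vec b))) c"
      using der[of h "vec b"] by (metis lookup_fsmult)
    also have "\<dots> = w c * Poly_Mapping.lookup (E (vec b)) c"
      using zero_weight_diagonal[OF Eh \<open>c \<noteq> b\<close>] by (simp add: lookup_add lookup_br_h)
    finally show ?thesis
      using that by simp
  qed
  have diag: "E (vec b) = fsmult (Poly_Mapping.lookup (E (vec b)) b) (vec b)" if "w b \<noteq> 0" for b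
    by (rule vec_multipleI) (metis off weights_distinct that)
  have zero: "E (vec a) = 0" if a: "w a = 0" for a
  proof (rule zero_faithful)
    show "Poly_Mapping.lookup (E (vec a)) b = 0" if "w b \<noteq> 0" for b
      using off[of b a] that a by auto
    show "br (E (vec a)) (vec b) = 0" if b: "w b \<noteq> 0" for b
    proof -
      obtain \<mu> where \<mu>: "br (vec a) (vec b) = fsmult \<mu> (vec b)"
        using vec_multipleI[of b "br (vec a) (vec b)"] zero_diagonal[OF a] by metis
      obtain l where l: "E (vec b) = fsmult l (vec b)"
        using diag[OF b] by metis
      have "fsmult \<mu> (fsmult l (vec b)) = br (E (vec a)) (vec b) + fsmult l (fsmult \<mu> (vec b))"
        using der[of "vec a" "vec b"] by (simp only: \<mu> l E.scale bracket_scale_right)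
      then show ?thesis
        by (simp add: mult.commute)
    qed
  qed
  show thesis
  proof (rule that)
    fix b
    show "E (vec b) = Poly_Mapping.single b (Poly_Mapping.lookup (E (vec b)) b)"
      using diag[of b] zero[of b] by (cases "w b = 0") simp_all
    show "w b = 0 \<Longrightarrow> Poly_Mapping.lookup (E (vec b)) b = 0"
      using zero by simp
  qed
qed

text \<open>
  This reduces completeness to a problem about scalars: the eigenvalues of a diagonal derivation are
  additive along nonzero brackets of basis elements, and each such system of eigenvalues has to come
  from an element of the algebra.
\<close>

theorem complete_if_additive_inner:
  assumes realize: "\<And>l. (\<And>b. w b = 0 \<Longrightarrow> l b = 0) \<Longrightarrow>
      (\<And>a b c \<mu>. br (vec a) (vec b) = Poly_Mapping.single c \<mu> \<Longrightarrow> \<mu> \<noteq> 0 \<Longrightarrow> l c = l a + l b) \<Longrightarrow>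
      \<exists>t. \<forall>b. br t (vec b) = Poly_Mapping.single b (l b)"
  shows "complete_lie_algebra fsmult br"
proof -
  have "inner_derivation D" if D: "derivation D" for D
  proof -
    obtain a where a: "\<And>c. w c \<noteq> 0 \<Longrightarrow> Poly_Mapping.lookup (D h - br a h) c = 0"
      using inner_correction[of "D h"] by blast
    define E where "E = (\<lambda>u. D u - br a u)"
    have E: "derivation E"
      using derivation_diff[OF D derivation_ad[of a]] by (simp add: E_def ad_def)
    obtain l where l: "\<And>b. E (vec b) = Poly_Mapping.single b (l b)" "\<And>b. w b = 0 \<Longrightarrow> l b = 0"
      using derivation_diagonal[OF E] a unfolding E_def by blast
    have lin: "Vector_Spaces.linear fsmult fsmult E"
      and der: "E (br u v) = br (E u) v + br u (E v)" for u v
      using E unfolding derivation_def by auto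
    interpret E: Vector_Spaces.linear fsmult fsmult E by fact
    have l_fsmult: "E (vec b) = fsmult (l b) (vec b)" for b
      by (simp add: l)
    have "l c = l a + l b"
      if br: "br (vec a) (vec b) = Poly_Mapping.single c \<mu>" and "\<mu> \<noteq> 0" for a b c \<mu>
    proof -
      have br': "br (vec a) (vec b) = fsmult \<mu> (vec c)"
        by (simp add: br)
      have "fsmult \<mu> (fsmult (l c) (vec c)) =
          fsmult (l a) (fsmult \<mu> (vec c)) + fsmult (l b) (fsmult \<mu> (vec c))"
        using der[of "vec a" "vec b"]
        by (simp only: br' E.scale l_fsmult bracket_scale_left bracket_scale_right)
      then have "Poly_Mapping.lookup (fsmult \<mu> (fsmult (l c) (vec c))) c = Poly_Mapping.lookup
          (fsmult (l a) (fsmult \<mu> (vec c)) + fsmult (l b) (fsmult \<mu> (vec c))) c"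
        by (rule arg_cong)
      then have "\<mu> * l c = \<mu> * (l a + l b)"
        by (simp add: lookup_add algebra_simps)
      then show ?thesis
        using \<open>\<mu> \<noteq> 0\<close> by simp
    qed
    with l(2) obtain t where t: "\<And>b. br t (vec b) = Poly_Mapping.single b (l b)"
      using realize[of l] by blast
    have "E = br t"
      by (rule linear_eqI[OF lin linear_bracket_right]) (simp add: t l)
    then have "D = ad (a + t)"
      unfolding E_def ad_def fun_eq_iff by (simp add: bracket_add_left algebra_simps)
    then show ?thesis
      unfolding inner_derivation_def by blast
  qed
  then show ?thesis
    by unfold_locales (simp_all add: center_trivial_weighted)
qed

end

section \<open>Completeness of the two algebras\<close>

lemma single_eq_0_iff: "Poly_Mapping.single k v = 0 \<longleftrightarrow> v = 0"
  by (metis lookup_single_eq lookup_zero single_zero)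

definition M0_weight :: "M0_basis \<Rightarrow> complex" where
  "M0_weight b = (case b of M0_E n \<Rightarrow> - of_nat (Suc n) | _ \<Rightarrow> 0)"

lemma complete_M0: "complete_lie_algebra fsmult M0_bracket"
proof -
  interpret lie_algebra fsmult M0_bracket
    by (rule lie_algebra_M0)
  let ?t = "\<lambda>\<alpha> \<beta>. Poly_Mapping.single M0_X \<alpha> + Poly_Mapping.single M0_Y \<beta>"
  have torus: "M0_bracket (?t \<alpha> \<beta>) (Poly_Mapping.single b 1) = Poly_Mapping.single b
      (case b of M0_E 0 \<Rightarrow> - \<alpha> | M0_E (Suc n) \<Rightarrow> - of_nat (n + 1) * \<alpha> - \<beta> | _ \<Rightarrow> 0)" for \<alpha> \<beta> b
    by (cases b rule: M0_basis_cases)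
      (simp_all add: M0_bracket_def bracket_simps algebra_simps)
  interpret weighted_lie_algebra M0_bracket "?t 1 1" M0_weight
  proof
    fix a b c :: M0_basis and z :: "M0_basis \<Rightarrow>\<^sub>0 complex"
    have w: "M0_weight (M0_E n) \<noteq> 0" for n
      by (simp add: M0_weight_def del: of_nat_Suc)
    show "M0_bracket (?t 1 1) (Poly_Mapping.single b 1) = Poly_Mapping.single b (M0_weight b)"
      by (simp only: torus) (auto simp: M0_weight_def split: M0_basis.splits nat.splits)
    show "M0_weight a = M0_weight b \<Longrightarrow> M0_weight a \<noteq> 0 \<Longrightarrow> a = b"
      by (auto simp: M0_weight_def split: M0_basis.splits)
    show "Poly_Mapping.lookup (M0_bracket (Poly_Mapping.single a 1) (Poly_Mapping.single b 1)) c = 0"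
      if "M0_weight a = 0" "c \<noteq> b"
    proof -
      have "a = M0_X \<or> a = M0_Y"
        using that(1) w by (cases a) auto
      then show ?thesis
        using torus[of 1 0 b] torus[of 0 1 b] that(2) by (auto simp: lookup_single when_def)
    qed
    assume zero: "\<And>b. M0_weight b \<noteq> 0 \<Longrightarrow> Poly_Mapping.lookup z b = 0"
      and triv: "\<And>b. M0_weight b \<noteq> 0 \<Longrightarrow> M0_bracket z (Poly_Mapping.single b 1) = 0"
    define \<alpha> \<beta> where "\<alpha> = Poly_Mapping.lookup z M0_X" and "\<beta> = Poly_Mapping.lookup z M0_Y"
    have "z = ?t \<alpha> \<beta>"
    proof (rule poly_mapping_eqI)
      show "Poly_Mapping.lookup z k = Poly_Mapping.lookup (?t \<alpha> \<beta>) k" for k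
        using zero[OF w] by (cases k) (simp_all add: \<alpha>_def \<beta>_def lookup_add lookup_single)
    qed
    moreover from this have "\<alpha> = 0"
      using triv[OF w, of 0] torus[of \<alpha> \<beta> "M0_E 0"] by (simp add: single_eq_0_iff)
    moreover from calculation have "\<beta> = 0"
      using triv[OF w, of 1] torus[of \<alpha> \<beta> "M0_E 1"] by (simp add: single_eq_0_iff)
    ultimately show "z = 0" by simp
  qed
  show ?thesis
  proof (rule complete_if_additive_inner)
    fix l :: "M0_basis \<Rightarrow> complex"
    assume zero: "\<And>b. M0_weight b = 0 \<Longrightarrow> l b = 0"
      and add: "\<And>a b c \<mu>. M0_bracket (vec a) (vec b) = Poly_Mapping.single c \<mu> \<Longrightarrow> \<mu> \<noteq> 0 \<Longrightarrow>
        l c = l a + l b"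
    define \<alpha> \<beta> where "\<alpha> = l (M0_E 0)" and "\<beta> = l (M0_E 1)"
    have step: "l (M0_E (Suc (Suc n))) = l (M0_E (Suc n)) + \<alpha>" for n
      using add[of "M0_E (Suc n)" "M0_E 0" "M0_E (Suc (Suc n))" 1]
      by (simp add: M0_bracket_def \<alpha>_def)
    have l: "l (M0_E (Suc n)) = \<beta> + of_nat n * \<alpha>" for n
      by (induction n) (simp_all add: step \<beta>_def algebra_simps)
    have "M0_bracket (?t (- \<alpha>) (\<alpha> - \<beta>)) (vec b) = Poly_Mapping.single b (l b)" for b
      unfolding torus
      by (cases b rule: M0_basis_cases)
        (simp_all add: zero[of M0_X] zero[of M0_Y] M0_weight_def l \<alpha>_def[symmetric] algebra_simps)
    then show "\<exists>t. \<forall>b. M0_bracket t (vec b) = Poly_Mapping.single b (l b)"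
      by blast
  qed
qed

definition M2_weight :: "M2_basis \<Rightarrow> complex" where
  "M2_weight b = (case b of M2_E n \<Rightarrow> - of_nat (Suc n) | M2_X \<Rightarrow> 0)"

lemma complete_M2: "complete_lie_algebra fsmult M2_bracket"
proof -
  interpret lie_algebra fsmult M2_bracket
    by (rule lie_algebra_M2)
  have torus: "M2_bracket (Poly_Mapping.single M2_X \<alpha>) (Poly_Mapping.single b 1) =
      Poly_Mapping.single b (\<alpha> * M2_weight b)" for \<alpha> b
    by (cases b) (simp_all add: M2_bracket_def M2_weight_def algebra_simps)
  interpret weighted_lie_algebra M2_bracket "Poly_Mapping.single M2_X 1" M2_weight
  proof
    fix a b c :: M2_basis and z :: "M2_basis \<Rightarrow>\<^sub>0 complex"
    have w: "M2_weight (M2_E n) \<noteq> 0" for n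
      by (simp add: M2_weight_def del: of_nat_Suc)
    show "M2_bracket (Poly_Mapping.single M2_X 1) (Poly_Mapping.single b 1) =
        Poly_Mapping.single b (M2_weight b)"
      by (simp add: torus)
    show "M2_weight a = M2_weight b \<Longrightarrow> M2_weight a \<noteq> 0 \<Longrightarrow> a = b"
      by (auto simp: M2_weight_def split: M2_basis.splits)
    show "Poly_Mapping.lookup (M2_bracket (Poly_Mapping.single a 1) (Poly_Mapping.single b 1)) c = 0"
      if "M2_weight a = 0" "c \<noteq> b"
      using that w by (cases a) (auto simp: torus lookup_single when_def)
    assume zero: "\<And>b. M2_weight b \<noteq> 0 \<Longrightarrow> Poly_Mapping.lookup z b = 0"
      and triv: "\<And>b. M2_weight b \<noteq> 0 \<Longrightarrow> M2_bracket z (Poly_Mapping.single b 1) = 0"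
    define \<alpha> where "\<alpha> = Poly_Mapping.lookup z M2_X"
    have "z = Poly_Mapping.single M2_X \<alpha>"
    proof (rule poly_mapping_eqI)
      show "Poly_Mapping.lookup z k = Poly_Mapping.lookup (Poly_Mapping.single M2_X \<alpha>) k" for k
        using zero[OF w] by (cases k) (simp_all add: \<alpha>_def lookup_single)
    qed
    then show "z = 0"
      using triv[OF w, of 0] torus[of \<alpha> "M2_E 0"] w[of 0] by (simp add: single_eq_0_iff)
  qed
  show ?thesis
  proof (rule complete_if_additive_inner)
    fix l :: "M2_basis \<Rightarrow> complex"
    assume zero: "\<And>b. M2_weight b = 0 \<Longrightarrow> l b = 0"
      and add: "\<And>a b c \<mu>. M2_bracket (vec a) (vec b) = Poly_Mapping.single c \<mu> \<Longrightarrow> \<mu> \<noteq> 0 \<Longrightarrow>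
        l c = l a + l b"
    define \<alpha> where "\<alpha> = l (M2_E 0)"
    have step: "l (M2_E (Suc (Suc n))) = \<alpha> + l (M2_E (Suc n))" for n
      using add[of "M2_E 0" "M2_E (Suc n)" "M2_E (Suc (Suc n))" 1]
      by (simp add: M2_bracket_def \<alpha>_def)
    \<comment> \<open>The bracket \<open>[e\<^sub>2, e\<^sub>3] = e\<^sub>5\<close> forces the eigenvalue of \<open>e\<^sub>2\<close> to be twice that of \<open>e\<^sub>1\<close>.\<close>
    have "l (M2_E 4) = l (M2_E 1) + l (M2_E 2)"
      using add[of "M2_E 1" "M2_E 2" "M2_E 4" 1] by (simp add: M2_bracket_def numeral_eq_Suc)
    then have two: "l (M2_E (Suc 0)) = 2 * \<alpha>"
      using step[of 0] step[of 1] step[of 2] by (simp add: numeral_eq_Suc)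
    have "l (M2_E (Suc n)) = of_nat (n + 2) * \<alpha>" for n
      by (induction n) (simp_all add: two step algebra_simps)
    then have l: "l (M2_E n) = of_nat (n + 1) * \<alpha>" for n
      by (cases n) (simp_all add: \<alpha>_def)
    have "M2_bracket (Poly_Mapping.single M2_X (- \<alpha>)) (vec b) = Poly_Mapping.single b (l b)" for b
      unfolding torus by (cases b) (simp_all add: zero[of M2_X] M2_weight_def l algebra_simps)
    then show "\<exists>t. \<forall>b. M2_bracket t (vec b) = Poly_Mapping.single b (l b)"
      by blast
  qed
qed

theorem theorem3p8:
  shows "complete_lie_algebra fsmult M0_bracket \<and> complete_lie_algebra fsmult M2_bracket"
  using complete_M0 complete_M2 by blast

end
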